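(* Let $\lambda=(\underbrace{0,\dots,0}_{j},\underbrace{1,\dots,1}_{k},\underbrace{0,\dots,0}_{l})\in\mathbb{Z}^{n-1}$ with $j,k,l\in\mathbb{Z}_+$ and $j+k+l=n-1$, and let $B=(1+\varepsilon)\cdot f^*_\lambda(s,t)$ for some $\varepsilon>0$. Then the cardinality of the minimal complete set $P^{NSP}_{min}(s,t)$ of UNSSPP$(G,\lambda)$ is intractable, i.e. it might be exponential in the number of vertices: there is a family of instances, consisting of directed graphs $G=(V,A)$ with arbitrarily large number $n=|V|$ of vertices, arc costs $c:A\to\mathbb{Z}_+$, vertices $s\ne t$, integers $j,k,l\in\mathbb{Z}_+$ with $j+k+l=n-1$ (part of the instance) and $\varepsilon>0$, on which $|P^{NSP}_{min}(s,t)|$ grows exponentially in $n$.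
   Context: $\mathbb{Z}_+$ denotes the nonnegative integers; directed graphs may have parallel arcs, and paths are distinguished by their arcs. $\mathcal{P}_{st}$ is the set of all simple directed $s$-$t$-paths in $G$; $l(P)\le n-1$ is the number of arcs of $P$. For a path $P$, $c_{(i)}(P)$ is the $i$-th largest arc cost on $P$ for $1\le i\le l(P)$, and $c_{(i)}(P)=0$ for $l(P)<i\le n-1$. $f_\lambda(P)=\sum_{i=1}^{n-1}\lambda_ic_{(i)}(P)$ and $f^*_\lambda(s,t)=\min_{P\in\mathcal{P}_{st}}f_\lambda(P)$. UNSSPP$(G,\lambda)$ asks to enumerate $P^{NSP}(s,t)=\{P\in\mathcal{P}_{st}: f_\lambda(P)\le B\}$. Two paths $P_1,P_2\in\mathcal{P}_{st}$ are equivalent iff $f_\lambda(P_1)=f_\lambda(P_2)$. A minimal complete set $P^{NSP}_{min}(s,t)\subseteq P^{NSP}(s,t)$ is a set such that every $P\in P^{NSP}(s,t)\setminus P^{NSP}_{min}(s,t)$ is equivalent to exactly one $P'\in P^{NSP}_{min}(s,t)$; being minimal, it contains exactly one representative of each equivalence class of $P^{NSP}(s,t)$. *)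

theory Defs
  imports Complex_Main "Graph_Theory.Arc_Walk"
begin

text \<open>
  Directed graphs are those of \<^theory>\<open>Graph_Theory.Digraph\<close>: arcs have an identity of their
  own, so parallel arcs are allowed, and a path is the list of its arcs.
\<close>

definition st_paths :: "('a, 'b) pre_digraph \<Rightarrow> 'a \<Rightarrow> 'a \<Rightarrow> 'b list set" where
  "st_paths G s t = {P. pre_digraph.apath G s P t}"

text \<open>Positions are counted from 1, as in \<open>c\<^sub>(\<^sub>i\<^sub>)(P)\<close>.\<close>

definition sorted_cost :: "('b \<Rightarrow> nat) \<Rightarrow> 'b list \<Rightarrow> nat \<Rightarrow> nat" where
  "sorted_cost c P i =
     (if 1 \<le> i \<and> i \<le> length P then rev (sort (map c P)) ! (i - 1) else 0)"

text \<open>The weight vector \<open>\<lambda>\<close> is a list of length \<open>n - 1\<close>, whose entry \<open>\<lambda>\<^sub>i\<close> is \<open>lam ! (i - 1)\<close>.\<close>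

definition usp_cost :: "('a, 'b) pre_digraph \<Rightarrow> ('b \<Rightarrow> nat) \<Rightarrow> int list \<Rightarrow> 'b list \<Rightarrow> int" where
  "usp_cost G c lam P =
     (\<Sum>i = 1..card (verts G) - 1. lam ! (i - 1) * int (sorted_cost c P i))"

text \<open>Unspecified if there is no path from \<open>s\<close> to \<open>t\<close>.\<close>

definition opt_cost :: "('a, 'b) pre_digraph \<Rightarrow> ('b \<Rightarrow> nat) \<Rightarrow> int list \<Rightarrow> 'a \<Rightarrow> 'a \<Rightarrow> int" where
  "opt_cost G c lam s t = Min (usp_cost G c lam ` st_paths G s t)"

definition near_shortest_paths ::
  "('a, 'b) pre_digraph \<Rightarrow> ('b \<Rightarrow> nat) \<Rightarrow> int list \<Rightarrow> real \<Rightarrow> 'a \<Rightarrow> 'a \<Rightarrow> 'b list set" where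
  "near_shortest_paths G c lam B s t =
     {P \<in> st_paths G s t. real_of_int (usp_cost G c lam P) \<le> B}"

definition complete_set ::
  "('a, 'b) pre_digraph \<Rightarrow> ('b \<Rightarrow> nat) \<Rightarrow> int list \<Rightarrow> real \<Rightarrow> 'a \<Rightarrow> 'a \<Rightarrow> 'b list set \<Rightarrow> bool" where
  "complete_set G c lam B s t M \<longleftrightarrow>
     M \<subseteq> near_shortest_paths G c lam B s t \<and>
     (\<forall>P \<in> near_shortest_paths G c lam B s t - M.
        \<exists>!P'. P' \<in> M \<and> usp_cost G c lam P = usp_cost G c lam P')"

text \<open>Minimality is with respect to inclusion; see \<open>minimal_complete_set_iff\<close> below.\<close>

definition minimal_complete_set ::
  "('a, 'b) pre_digraph \<Rightarrow> ('b \<Rightarrow> nat) \<Rightarrow> int list \<Rightarrow> real \<Rightarrow> 'a \<Rightarrow> 'a \<Rightarrow> 'b list set \<Rightarrow> bool" where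
  "minimal_complete_set G c lam B s t M \<longleftrightarrow>
     complete_set G c lam B s t M \<and>
     (\<forall>M'. complete_set G c lam B s t M' \<and> M' \<subseteq> M \<longrightarrow> M' = M)"

text \<open>
  A minimal complete set contains exactly one representative of each equivalence class.
  Consequently such sets exist, and they all have the same cardinality.
\<close>

lemma minimal_complete_set_iff:
  "minimal_complete_set G c lam B s t M \<longleftrightarrow>
     M \<subseteq> near_shortest_paths G c lam B s t \<and>
     (\<forall>P \<in> near_shortest_paths G c lam B s t.
        \<exists>!P'. P' \<in> M \<and> usp_cost G c lam P = usp_cost G c lam P')"
  (is "_ \<longleftrightarrow> M \<subseteq> ?N \<and> ?R")
proof
  let ?f = "usp_cost G c lam"
  assume min: "minimal_complete_set G c lam B s t M"
  then have sub: "M \<subseteq> ?N"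
    and cov: "\<And>P. P \<in> ?N - M \<Longrightarrow> \<exists>!P'. P' \<in> M \<and> ?f P = ?f P'"
    unfolding minimal_complete_set_def complete_set_def by blast+
  have inj: "P = Q" if "P \<in> M" "Q \<in> M" "?f P = ?f Q" for P Q
  proof (rule ccontr)
    assume "P \<noteq> Q"
    define M' where "M' = {X \<in> M. ?f X = ?f P \<longrightarrow> X = P}"
    have "complete_set G c lam B s t M'"
      unfolding complete_set_def
    proof (intro conjI ballI)
      show "M' \<subseteq> ?N" using sub by (auto simp: M'_def)
      fix X assume X: "X \<in> ?N - M'"
      show "\<exists>!P'. P' \<in> M' \<and> ?f X = ?f P'"
      proof (cases "?f X = ?f P")
        case True
        then show ?thesis using that(1) by (auto simp: M'_def)
      next
        case False
        then have "X \<in> ?N - M" using X by (auto simp: M'_def)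
        from cov[OF this] False show ?thesis by (auto simp: M'_def)
      qed
    qed
    moreover have "M' \<subseteq> M" by (auto simp: M'_def)
    ultimately have "M' = M" using min by (simp add: minimal_complete_set_def)
    then show False using that \<open>P \<noteq> Q\<close> by (auto simp: M'_def)
  qed
  have ?R
  proof
    fix P assume "P \<in> ?N"
    then show "\<exists>!P'. P' \<in> M \<and> ?f P = ?f P'"
    proof (cases "P \<in> M")
      case True
      show ?thesis
      proof (rule ex1I[of _ P])
        show "P \<in> M \<and> ?f P = ?f P" using True by simp
        show "Q = P" if "Q \<in> M \<and> ?f P = ?f Q" for Q
          using inj[of Q P] that True by simp
      qed
    next
      case False
      then show ?thesis using cov \<open>P \<in> ?N\<close> by simp
    qed
  qed
  with sub show "M \<subseteq> ?N \<and> ?R" by blast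
next
  let ?f = "usp_cost G c lam"
  assume R: "M \<subseteq> ?N \<and> ?R"
  then have "complete_set G c lam B s t M" by (simp add: complete_set_def)
  moreover have "M' = M" if M': "complete_set G c lam B s t M'" "M' \<subseteq> M" for M'
  proof (rule ccontr)
    assume "M' \<noteq> M"
    then obtain P where P: "P \<in> M" "P \<notin> M'" using M'(2) by blast
    with R have PN: "P \<in> ?N - M'" by blast
    then have "\<exists>!P'. P' \<in> M' \<and> ?f P = ?f P'"
      using M'(1) unfolding complete_set_def by simp
    then obtain Q where Q: "Q \<in> M'" "?f P = ?f Q" by blast
    have "\<exists>!P'. P' \<in> M \<and> ?f P = ?f P'" using R PN by simp
    moreover have "Q \<in> M" using Q(1) M'(2) by blast
    ultimately have "P = Q" using P(1) Q(2) by blast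
    then show False using P(2) Q(1) by simp
  qed
  ultimately show "minimal_complete_set G c lam B s t M"
    by (simp add: minimal_complete_set_def)
qed

lemma minimal_complete_set_exists: "\<exists>M. minimal_complete_set G c lam B s t M"
proof -
  let ?N = "near_shortest_paths G c lam B s t" and ?f = "usp_cost G c lam"
  obtain M where M: "M \<subseteq> ?N" "inj_on ?f M" "?f ` ?N = ?f ` M"
    using subset_image_inj[of "?f ` ?N" ?f ?N] by blast
  have "\<exists>!P'. P' \<in> M \<and> ?f P = ?f P'" if "P \<in> ?N" for P
  proof -
    have "?f P \<in> ?f ` M" using M(3) that by blast
    then obtain P' where P': "P' \<in> M" "?f P = ?f P'" by blast
    show ?thesis
    proof (rule ex1I[of _ P'])
      show "P' \<in> M \<and> ?f P = ?f P'" using P' by simp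
      show "Q = P'" if "Q \<in> M \<and> ?f P = ?f Q" for Q
        using inj_onD[OF M(2), of Q P'] that P' by simp
    qed
  qed
  with M(1) have "minimal_complete_set G c lam B s t M"
    unfolding minimal_complete_set_iff by blast
  then show ?thesis ..
qed

lemma card_minimal_complete_set:
  assumes "minimal_complete_set G c lam B s t M"
  shows "card M = card (usp_cost G c lam ` near_shortest_paths G c lam B s t)"
proof -
  let ?N = "near_shortest_paths G c lam B s t" and ?f = "usp_cost G c lam"
  have M: "M \<subseteq> ?N" "\<forall>P \<in> ?N. \<exists>!P'. P' \<in> M \<and> ?f P = ?f P'"
    using assms unfolding minimal_complete_set_iff by blast+
  have "inj_on ?f M"
  proof (rule inj_onI)
    fix P Q assume "P \<in> M" "Q \<in> M" "?f P = ?f Q"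
    with M show "P = Q" by blast
  qed
  moreover have "?f ` M = ?f ` ?N"
  proof
    show "?f ` M \<subseteq> ?f ` ?N" using M(1) by (rule image_mono)
    show "?f ` ?N \<subseteq> ?f ` M"
    proof (rule image_subsetI)
      fix P assume "P \<in> ?N"
      with M(2) obtain P' where "P' \<in> M" "?f P = ?f P'" by blast
      then show "?f P \<in> ?f ` M" by simp
    qed
  qed
  ultimately show ?thesis by (metis card_image)
qed

end

theory Submission
  imports Defs "HOL-Library.Multiset"
begin

text \<open>
  For \<open>\<lambda> = (1, \<dots>, 1)\<close> the cost of a path is the sum of its arc costs. In a chain of \<open>m\<close> pairs
  of parallel arcs whose \<open>i\<close>-th pair has costs \<open>2\<^sup>i\<close> and \<open>2 \<cdot> 2\<^sup>i\<close>, the sums realise every value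
  \<open>2\<^sup>m - 1 + x\<close> with \<open>x < 2\<^sup>m\<close> (binary expansion of \<open>x\<close>). All costs being positive, the optimum is
  at least 1, so a sufficiently large \<open>\<epsilon>\<close> admits all these paths: there are at least
  \<open>2\<^sup>m \<ge> (\<surd>2)\<^sup>m\<^sup>+\<^sup>1\<close> equivalence classes on \<open>m + 1\<close> vertices.
\<close>

text \<open>Sorting only permutes the arc costs, and positions past the end of \<open>P\<close>
  contribute 0. The length bound ensures that all arc costs lie in the range of summation.\<close>

lemma usp_cost_replicate_one:
  assumes "length P \<le> card (verts G) - 1"
  shows "usp_cost G c (replicate (card (verts G) - 1) 1) P = int (sum_list (map c P))"
proof -
  let ?n = "card (verts G) - 1" and ?s = "rev (sort (map c P))"
  have "usp_cost G c (replicate ?n 1) P = (\<Sum>i = 1..?n. int (sorted_cost c P i))"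
    unfolding usp_cost_def by (rule sum.cong) auto
  also have "\<dots> = (\<Sum>i = 1..length P. int (sorted_cost c P i))"
    using assms by (intro sum.mono_neutral_right) (auto simp: sorted_cost_def)
  also have "\<dots> = (\<Sum>i = 1..length P. int (?s ! (i - 1)))"
    by (rule sum.cong) (auto simp: sorted_cost_def)
  also have "\<dots> = (\<Sum>i < length P. int (?s ! i))"
    by (rule sum.reindex_bij_witness[of _ Suc "\<lambda>i. i - 1"]) auto
  also have "\<dots> = int (sum_list ?s)"
    by (simp add: sum_list_sum_nth atLeast0LessThan)
  also have "sum_list ?s = sum_list (map c P)"
    by (metis mset_sort sum_list_rev sum_mset_sum_list)
  finally show ?thesis .
qed

text \<open>Arcs lead downwards, so that a path to 0 grows by prepending an arc, as in the recursion
  on lists. The parity of an arc tells it from its parallel twin and serves as a binary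
  digit.\<close>

definition double_chain :: "nat \<Rightarrow> (nat, nat) pre_digraph" where
  "double_chain m = \<lparr>verts = {0..m}, arcs = {0..<2 * m}, tail = (\<lambda>e. Suc (e div 2)), head = (\<lambda>e. e div 2)\<rparr>"

definition chain_cost :: "nat \<Rightarrow> nat" where
  "chain_cost e = 2 ^ (e div 2) * (1 + e mod 2)"

lemma double_chain_simps [simp]:
  "verts (double_chain m) = {0..m}" "arcs (double_chain m) = {0..<2 * m}"
  "tail (double_chain m) e = Suc (e div 2)" "head (double_chain m) e = e div 2"
  by (simp_all add: double_chain_def)

lemma fin_digraph_double_chain: "fin_digraph (double_chain m)"
  by unfold_locales auto

text \<open>By induction on \<open>k\<close>, the leading binary digit of \<open>x\<close> selects
  the first arc and the remaining digits select the rest. The bound on the visited vertices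
  strengthens the induction so that the extended path can be shown to be simple.\<close>

lemma double_chain_path:
  assumes "k \<le> m" "x < 2 ^ k"
  shows "\<exists>P. pre_digraph.apath (double_chain m) k P 0 \<and>
    set (pre_digraph.awalk_verts (double_chain m) k P) \<subseteq> {0..k} \<and>
    sum_list (map chain_cost P) = 2 ^ k - 1 + x"
  using assms
proof (induction k arbitrary: x)
  case 0
  interpret fin_digraph "double_chain m" by (rule fin_digraph_double_chain)
  show ?case using 0 by (intro exI[of _ "[]"]) (auto simp: apath_Nil_iff)
next
  case (Suc k)
  interpret fin_digraph "double_chain m" by (rule fin_digraph_double_chain)
  define b where "b = x div 2 ^ k"
  have b: "b < 2" using Suc.prems(2) by (simp add: b_def less_mult_imp_div_less)
  have "x mod 2 ^ k < 2 ^ k" by simp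
  from Suc.IH[OF _ this] Suc.prems(1) obtain P where P: "apath k P 0"
    "set (awalk_verts k P) \<subseteq> {0..k}" "sum_list (map chain_cost P) = 2 ^ k - 1 + x mod 2 ^ k"
    by auto
  have e: "(2 * k + b) div 2 = k" "(2 * k + b) mod 2 = b" using b by auto
  have "x = 2 ^ k * b + x mod 2 ^ k" by (simp add: b_def)
  moreover have "chain_cost (2 * k + b) = 2 ^ k + 2 ^ k * b"
    unfolding chain_cost_def e by (simp add: algebra_simps)
  \<comment> \<open>Subtraction on naturals truncates; this fact makes \<open>2 ^ k - 1\<close>
    exact.\<close>
  moreover have "(1::nat) \<le> 2 ^ k" by simp
  ultimately have "chain_cost (2 * k + b) + sum_list (map chain_cost P) = 2 ^ Suc k - 1 + x"
    using P(3) unfolding power_Suc by linarith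
  \<comment> \<open>The new start \<open>Suc k\<close> lies outside {0..k}, hence is not visited by
    \<open>P\<close>.\<close>
  moreover have "apath (Suc k) ((2 * k + b) # P) 0"
    using P(1,2) b Suc.prems(1) by (auto simp: apath_Cons_iff e)
  ultimately show ?case using P(2) e by (intro exI[of _ "(2 * k + b) # P"]) auto
qed

theorem corollary4p7:
  shows "\<exists>a::real. a > 1 \<and>
    (\<forall>N::nat. \<exists>(G :: (nat, nat) pre_digraph) (c :: nat \<Rightarrow> nat) (s :: nat) (t :: nat)
        (j :: nat) (k :: nat) (l :: nat) (\<epsilon> :: real) (lam :: int list) (B :: real).
      fin_digraph G \<and> N \<le> card (verts G) \<and>
      s \<in> verts G \<and> t \<in> verts G \<and> s \<noteq> t \<and>
      j + k + l = card (verts G) - 1 \<and>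
      lam = replicate j 0 @ replicate k 1 @ replicate l 0 \<and>
      \<epsilon> > 0 \<and>
      B = (1 + \<epsilon>) * real_of_int (opt_cost G c lam s t) \<and>
      (\<forall>M. minimal_complete_set G c lam B s t M \<longrightarrow> a ^ card (verts G) \<le> real (card M)))"
proof (intro exI[of _ "sqrt 2"] conjI allI)
  show "sqrt 2 > 1" by simp
  fix N :: nat
  \<comment> \<open>A positive \<open>m\<close> keeps the endpoints \<open>m\<close> and 0
    distinct.\<close>
  define m where "m = Suc N"
  define lam :: "int list" where "lam = replicate m 1"
  let ?G = "double_chain m"
  let ?f = "usp_cost ?G chain_cost lam"
  \<comment> \<open>The choice \<epsilon> = \<open>2 ^ Suc m\<close> exceeds every sum
    \<open>2 ^ m - 1 + x\<close> with \<open>x < 2 ^ m\<close>.\<close>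
  define B where "B = (1 + 2 ^ Suc m) * real_of_int (opt_cost ?G chain_cost lam m 0)"
  interpret fin_digraph ?G by (rule fin_digraph_double_chain)
  have cost: "?f P = int (sum_list (map chain_cost P))" if "P \<in> st_paths ?G m 0" for P
  proof -
    have "length P < card (verts ?G)"
      using that length_apath_less by (simp add: st_paths_def)
    then show ?thesis
      using usp_cost_replicate_one[of P ?G chain_cost] by (simp add: lam_def)
  qed
  have cost_ge: "?f P \<ge> 1" if P: "P \<in> st_paths ?G m 0" for P
  proof (cases P)
    case Nil
    then have "m = 0" using P by (simp add: st_paths_def apath_Nil_iff)
    then show ?thesis by (simp add: m_def)
  next
    case (Cons e Q)
    have "chain_cost e \<ge> 1" by (simp add: chain_cost_def Suc_le_eq del: mult_Suc_right)
    then show ?thesis using cost[OF P] Cons by simp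
  qed
  have fin: "finite (st_paths ?G m 0)"
    unfolding st_paths_def by (rule apaths_finite)
  have path: "\<exists>P \<in> st_paths ?G m 0. ?f P = int (2 ^ m - 1 + x)" if "x < 2 ^ m" for x
    using double_chain_path[OF order_refl that] cost by (force simp: st_paths_def)
  \<comment> \<open>Together with finiteness this makes the \<open>Min\<close> in
    \<open>opt_cost\<close> an attained minimum.\<close>
  have "st_paths ?G m 0 \<noteq> {}" using path[of 0] by auto
  then have "opt_cost ?G chain_cost lam m 0 \<ge> 1"
    unfolding opt_cost_def using fin cost_ge by simp
  then have B: "B \<ge> 1 + 2 ^ Suc m"
    using mult_left_mono[of 1 "real_of_int (opt_cost ?G chain_cost lam m 0)" "1 + 2 ^ Suc m"]
    by (simp add: B_def)
  have near: "(\<lambda>x. int (2 ^ m - 1 + x)) ` {..<2 ^ m} \<subseteq> ?f ` near_shortest_paths ?G chain_cost lam B m 0"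
  proof (rule image_subsetI)
    fix x :: nat assume "x \<in> {..<2 ^ m}"
    then have x: "x < 2 ^ m" by simp
    then obtain P where P: "P \<in> st_paths ?G m 0" "?f P = int (2 ^ m - 1 + x)"
      using path by blast
    have "2 ^ m - 1 + x \<le> 2 ^ Suc m" using x by simp
    then have "real (2 ^ m - 1 + x) \<le> 2 ^ Suc m" by (metis of_nat_le_iff of_nat_numeral of_nat_power)
    then have "real_of_int (?f P) \<le> B" using P(2) B by simp
    then show "int (2 ^ m - 1 + x) \<in> ?f ` near_shortest_paths ?G chain_cost lam B m 0"
      using P by (force simp: near_shortest_paths_def)
  qed
  \<comment> \<open>Distinct \<open>x\<close> give distinct costs, so counting cost values yields
    the bound.\<close>
  have "finite (?f ` near_shortest_paths ?G chain_cost lam B m 0)"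
    using fin by (auto simp: near_shortest_paths_def)
  from card_mono[OF this near] have "2 ^ m \<le> card (?f ` near_shortest_paths ?G chain_cost lam B m 0)"
    by (simp add: card_image inj_on_def)
  then have card: "2 ^ m \<le> card M" if "minimal_complete_set ?G chain_cost lam B m 0 M" for M
    using card_minimal_complete_set[OF that] by simp
  \<comment> \<open>There are \<open>m + 1\<close> vertices, and \<open>m + 1 \<le> 2 * m\<close>
    since \<open>m\<close> is positive; the base \<open>sqrt 2\<close> absorbs the extra
    vertex.\<close>
  have "sqrt 2 ^ Suc m \<le> sqrt 2 ^ (2 * m)"
    by (rule power_increasing) (simp_all add: m_def)
  also have "\<dots> = 2 ^ m" by (simp add: power_mult)
  finally have root: "sqrt 2 ^ Suc m \<le> 2 ^ m" .
  have large: "sqrt 2 ^ card (verts ?G) \<le> real (card M)"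
    if "minimal_complete_set ?G chain_cost lam B m 0 M" for M
  proof -
    have "(2::real) ^ m \<le> real (card M)"
      using card[OF that] by (metis of_nat_le_iff of_nat_numeral of_nat_power)
    with root have "sqrt 2 ^ Suc m \<le> real (card M)" by (rule order_trans)
    then show ?thesis by simp
  qed
  show "\<exists>(G :: (nat, nat) pre_digraph) (c :: nat \<Rightarrow> nat) (s :: nat) (t :: nat)
        (j :: nat) (k :: nat) (l :: nat) (\<epsilon> :: real) (lam :: int list) (B :: real).
      fin_digraph G \<and> N \<le> card (verts G) \<and>
      s \<in> verts G \<and> t \<in> verts G \<and> s \<noteq> t \<and>
      j + k + l = card (verts G) - 1 \<and>
      lam = replicate j 0 @ replicate k 1 @ replicate l 0 \<and>
      \<epsilon> > 0 \<and>
      B = (1 + \<epsilon>) * real_of_int (opt_cost G c lam s t) \<and>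
      (\<forall>M. minimal_complete_set G c lam B s t M \<longrightarrow> sqrt 2 ^ card (verts G) \<le> real (card M))"
    by (rule exI[of _ ?G], rule exI[of _ chain_cost], rule exI[of _ m], rule exI[of _ 0],
        rule exI[of _ 0], rule exI[of _ m], rule exI[of _ 0], rule exI[of _ "2 ^ Suc m"],
        rule exI[of _ lam], rule exI[of _ B], intro conjI allI impI large)
      (simp_all add: fin_digraph_double_chain m_def lam_def B_def)
qed

end
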